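(* The following statements are equivalent: (i) Kurepa's hypothesis holds: for every integer $n\ge 2$, $\gcd(!n,\,n!)=2$; (ii) $S_{p-1}\not\equiv 0\pmod p$ for every prime $p\ge 3$; (iii) $S_{n-1}\not\equiv 0\pmod n$ for every integer $n\ge 3$; (iv) for every integer $n\ge 3$, the numerator of the rational number $\sum_{k=0}^{n-1}\frac{(-1)^k}{k!}$ written in lowest terms is not divisible by $n$.
   Context: The left factorial is $!0=0$ and $!n=\sum_{k=0}^{n-1}k!$ for $n\ge 1$. The derangement numbers are $S_k=k!\sum_{i=0}^{k}\frac{(-1)^i}{i!}$ for $k\ge 0$. *)

theory Defs
  imports Complex_Main "HOL-Computational_Algebra.Primes" "HOL-Number_Theory.Cong"
begin

definition left_factorial :: "nat \<Rightarrow> nat"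
  where "left_factorial n = (\<Sum>k<n. fact k)"

definition kurepa_hypothesis :: bool
  where "kurepa_hypothesis \<longleftrightarrow> (\<forall>n::nat. n \<ge> 2 \<longrightarrow> gcd (left_factorial n) (fact n) = 2)"

(* The rational number under the floor is an integer (lemma of_int_derangement),
   so the floor only converts it to type int. *)
definition derangement :: "nat \<Rightarrow> int"
  where "derangement k = \<lfloor>fact k * (\<Sum>i=0..k. (-1) ^ i / fact i) :: rat\<rfloor>"

lemma of_int_derangement:
  "of_int (derangement k) = (fact k * (\<Sum>i=0..k. (-1) ^ i / fact i) :: rat)"
proof -
  have "fact k * ((-1) ^ i / fact i) \<in> (\<int> :: rat set)" if "i \<in> {0..k}" for i
  proof -
    have "fact i dvd (fact k :: int)"
      using that by (simp add: fact_dvd)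
    then obtain c :: int where c: "fact k = fact i * c" ..
    have "(fact k :: rat) = of_int (fact k)" by simp
    also have "\<dots> = fact i * of_int c" by (simp only: c of_int_mult of_int_fact)
    finally have "fact k * ((-1) ^ i / fact i) = (of_int ((-1) ^ i * c) :: rat)"
      by simp
    then show ?thesis by (metis Ints_of_int)
  qed
  then have "fact k * (\<Sum>i=0..k. (-1) ^ i / fact i) \<in> (\<int> :: rat set)"
    unfolding sum_distrib_left by (intro Ints_sum) simp
  then show ?thesis
    unfolding derangement_def by (auto elim: Ints_cases)
qed

definition numerator :: "rat \<Rightarrow> int"
  where "numerator r = fst (quotient_of r)"

end

theory Submission
  imports Defs
begin

text \<open>
  Modulo \<open>n\<close> the falling factorial \<open>(n - 1) (n - 2) \<cdots> (n - m)\<close> is \<open>(-1)\<^sup>m m!\<close>, so that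
  \<open>S\<^bsub>n-1\<^esub> \<equiv> (-1)\<^bsup>n-1\<^esup> !n\<close> for every \<open>n\<close>, prime or not; all conditions thus become conditions on
  the left factorial. For \<open>d \<le> n\<close> the residue of \<open>!n\<close> modulo \<open>d\<close> is that of \<open>!d\<close>, which reduces
  everything to prime divisors, except for the powers of \<open>2\<close>: these are handled by
  \<open>!4 = 10 \<equiv> 2\<close> modulo \<open>4\<close>. Finally \<open>S\<^bsub>n-1\<^esub>\<close> is a multiple of the numerator in (iv), with a
  cofactor dividing \<open>(n - 1)!\<close>, hence prime to \<open>n\<close> when \<open>n\<close> is prime.
\<close>

lemma falling_factorial_times_fact:
  assumes "m < n"
  shows "(\<Prod>j<m. int n - 1 - int j) * fact (n - Suc m) = fact (n - 1)"
  using assms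
proof (induction m)
  case (Suc m)
  then have "n - Suc m = Suc (n - Suc (Suc m))" by simp
  then have "(fact (n - Suc m) :: int) = int (Suc (n - Suc (Suc m))) * fact (n - Suc (Suc m))"
    by (metis fact_Suc)
  also have "int (Suc (n - Suc (Suc m))) = int n - 1 - int m"
    using Suc.prems by simp
  finally show ?case
    using Suc by (simp add: mult.assoc)
qed simp

lemma falling_factorial_cong:
  "[(\<Prod>j<m. int n - 1 - int j) = (-1) ^ m * fact m] (mod int n)"
proof (induction m)
  case (Suc m)
  have "[int n - 1 - int m = - int (Suc m)] (mod int n)"
    by (simp add: cong_iff_dvd_diff)
  from cong_mult[OF Suc this] show ?case
    by (simp add: algebra_simps)
qed simp

text \<open>Substituting \<open>i = n - 1 - m\<close> in the defining sum turns each quotient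
  \<open>(n - 1)! / i!\<close> into a falling factorial with \<open>m\<close> factors. This removes
  all division, so the sum can be reduced modulo \<open>n\<close> term by term.\<close>

lemma derangement_eq_sum_falling_factorial:
  assumes "n > 0"
  shows "derangement (n - 1) = (\<Sum>m<n. (-1) ^ (n - Suc m) * (\<Prod>j<m. int n - 1 - int j))"
proof -
  have "(of_int (derangement (n - 1)) :: rat)
      = (\<Sum>i<n. fact (n - 1) * ((-1) ^ i / fact i))"
    using assms
    by (subst of_int_derangement) (auto simp: sum_distrib_left intro!: sum.cong)
  also have "\<dots> = (\<Sum>m<n. fact (n - 1) * ((-1) ^ (n - Suc m) / fact (n - Suc m)))"
    by (rule sum.nat_diff_reindex [symmetric])
  also have "\<dots> = (\<Sum>m<n. of_int ((-1) ^ (n - Suc m) * (\<Prod>j<m. int n - 1 - int j)))"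
  proof (rule sum.cong [OF refl])
    fix m assume "m \<in> {..<n}"
    then have "(fact (n - 1) :: rat)
        = of_int ((\<Prod>j<m. int n - 1 - int j) * fact (n - Suc m))"
      by (subst falling_factorial_times_fact) simp_all
    then show "fact (n - 1) * ((-1) ^ (n - Suc m) / fact (n - Suc m))
        = (of_int ((-1) ^ (n - Suc m) * (\<Prod>j<m. int n - 1 - int j)) :: rat)"
      by simp
  qed
  finally show ?thesis
    by (simp only: of_int_sum [symmetric] of_int_eq_iff)
qed

lemma derangement_cong_left_factorial:
  assumes "n > 0"
  shows "[derangement (n - 1) = (-1) ^ (n - 1) * int (left_factorial n)] (mod int n)"
proof -
  have "[derangement (n - 1) = (\<Sum>m<n. (-1) ^ (n - Suc m) * ((-1) ^ m * fact m))] (mod int n)"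
    unfolding derangement_eq_sum_falling_factorial[OF assms]
    by (intro cong_sum cong_scalar_left falling_factorial_cong)
  \<comment> \<open>The sign does not depend on \<open>m\<close>, because the exponents
    \<open>n - Suc m\<close> and \<open>m\<close> add up to \<open>n - 1\<close>.\<close>
  also have "(\<Sum>m<n. (-1) ^ (n - Suc m) * ((-1) ^ m * fact m))
      = (\<Sum>m<n. (-1) ^ (n - 1) * (fact m :: int))"
    by (rule sum.cong) (auto simp flip: power_add mult.assoc)
  finally show ?thesis
    by (simp add: left_factorial_def sum_distrib_left)
qed

lemma derangement_cong_0_iff:
  assumes "n > 0"
  shows "[derangement (n - 1) = 0] (mod int n) \<longleftrightarrow> n dvd left_factorial n"
proof -
  have "[derangement (n - 1) = 0] (mod int n)
      \<longleftrightarrow> int n dvd (-1) ^ (n - 1) * int (left_factorial n)"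
    using derangement_cong_left_factorial[OF assms] by (simp add: cong_0_iff cong_dvd_iff)
  also have "\<dots> \<longleftrightarrow> int n dvd int (left_factorial n)"
    by (cases "even (n - 1)") auto
  finally show ?thesis by simp
qed

text \<open>The extra summands \<open>k!\<close> with \<open>d \<le> k < n\<close> are all multiples
  of \<open>d\<close>.\<close>

lemma left_factorial_cong:
  assumes "0 < d" "d \<le> n"
  shows "[left_factorial n = left_factorial d] (mod d)"
  using assms(2)
proof (induction n rule: dec_induct)
  case (step n)
  have "[fact n = 0] (mod d)"
    using assms(1) step.hyps by (simp add: cong_0_iff dvd_fact)
  from cong_add[OF step.IH this] show ?case
    by (simp add: left_factorial_def)
qed simp

lemma not_4_dvd_left_factorial:
  assumes "n \<ge> 4"
  shows "\<not> 4 dvd left_factorial n"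
proof -
  have "left_factorial 4 = 10"
    by (simp add: left_factorial_def eval_nat_numeral)
  with left_factorial_cong[of 4 n] assms show ?thesis
    by (simp add: cong_dvd_iff)
qed

lemma even_left_factorial:
  assumes "n \<ge> 2"
  shows "even (left_factorial n)"
proof -
  have "left_factorial 2 = 2"
    by (simp add: left_factorial_def eval_nat_numeral)
  with left_factorial_cong[of 2 n] assms show ?thesis
    by (simp add: cong_dvd_iff)
qed

text \<open>Write \<open>n = 2 * m\<close> with \<open>m \<noteq> 1\<close>: a prime factor of
  \<open>m\<close> is either odd, or it is 2 and contributes a second factor 2. This is meant for an
  even gcd other than 2.\<close>

lemma even_imp_odd_prime_factor_or_4_dvd:
  fixes n :: nat
  assumes "n \<noteq> 2" "even n"
  obtains p where "prime p" "p \<ge> 3" "p dvd n" | "4 dvd n"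
proof -
  from assms obtain m where m: "n = 2 * m" "m \<noteq> 1" by auto
  from m(2) obtain p where p: "prime p" "p dvd m"
    using prime_factor_nat by blast
  show thesis
  proof (cases "p = 2")
    case True
    with m p have "4 dvd n" by auto
    then show thesis by (rule that(2))
  next
    case False
    with prime_ge_2_nat[OF p(1)] have "p \<ge> 3" by simp
    with p m show thesis by (intro that(1)) auto
  qed
qed

lemma odd_prime_factor_or_4_dvd:
  fixes n :: nat
  assumes "n \<ge> 3"
  obtains p where "prime p" "p \<ge> 3" "p dvd n" | "4 dvd n"
proof (cases "even n")
  case True
  with assms that even_imp_odd_prime_factor_or_4_dvd[of n] show thesis by auto
next
  case False
  from assms obtain p where p: "prime p" "p dvd n"
    using prime_factor_nat[of n] by auto
  with False have "p \<noteq> 2" by auto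
  with prime_ge_2_nat[OF p(1)] have "p \<ge> 3" by simp
  with p show thesis by (intro that(1))
qed

lemma kurepa_hypothesis_iff_prime:
  "kurepa_hypothesis \<longleftrightarrow> (\<forall>p. prime p \<and> p \<ge> 3 \<longrightarrow> \<not> p dvd left_factorial p)"
proof (intro iffI allI impI notI)
  fix p :: nat
  assume kurepa_hypothesis and p: "prime p \<and> p \<ge> 3" and "p dvd left_factorial p"
  then have "gcd (left_factorial p) (fact p) = 2"
    by (simp add: kurepa_hypothesis_def)
  moreover have "p dvd gcd (left_factorial p) (fact p)"
    using p \<open>p dvd left_factorial p\<close> by (simp add: dvd_fact)
  ultimately have "p dvd 2" by simp
  with p show False
    by (auto dest: dvd_imp_le)
next
  assume H: "\<forall>p. prime p \<and> p \<ge> 3 \<longrightarrow> \<not> p dvd left_factorial p"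
  show kurepa_hypothesis
    unfolding kurepa_hypothesis_def
  proof (intro allI impI)
    fix n :: nat
    assume n: "n \<ge> 2"
    let ?g = "gcd (left_factorial n) (fact n)"
    show "?g = 2"
    proof (rule ccontr)
      assume "?g \<noteq> 2"
      moreover have "even ?g"
        using n even_left_factorial dvd_fact[of 2 n] by simp
      ultimately show False
      proof (cases rule: even_imp_odd_prime_factor_or_4_dvd)
        case (1 p)
        \<comment> \<open>The gcd divides \<open>n!\<close>, which bounds \<open>p\<close> and so
          allows passing from \<open>!n\<close> to \<open>!p\<close> modulo
          \<open>p\<close>.\<close>
        then have "p \<le> n" by (simp add: prime_dvd_fact_iff)
        with 1 have "p dvd left_factorial p"
          using left_factorial_cong[of p n] by (simp add: cong_dvd_iff prime_gt_0_nat)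
        with H 1 show False by blast
      next
        case 2
        \<comment> \<open>A gcd divisible by 4 needs 4 to divide both arguments: \<open>!n\<close>
          rules this out from 4 on, and the values 2 and 6 of \<open>n!\<close> rule it out for
          \<open>n = 2\<close> and \<open>n = 3\<close>.\<close>
        then have "\<not> n \<ge> 4" using not_4_dvd_left_factorial by auto
        with n have "n = 2 \<or> n = 3" by auto
        then have "fact n = (2 :: nat) \<or> fact n = (6 :: nat)"
          by (auto simp: fact_numeral)
        moreover from 2 have "4 dvd (fact n :: nat)" by simp
        ultimately show False by auto
      qed
    qed
  qed
qed

lemma dvd_left_factorial_prime_iff_all:
  "(\<forall>p. prime p \<and> p \<ge> 3 \<longrightarrow> \<not> p dvd left_factorial p)
    \<longleftrightarrow> (\<forall>n\<ge>3. \<not> n dvd left_factorial n)"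
proof (intro iffI allI impI notI)
  fix n :: nat
  assume H: "\<forall>p. prime p \<and> p \<ge> 3 \<longrightarrow> \<not> p dvd left_factorial p"
    and n: "n \<ge> 3" "n dvd left_factorial n"
  from n(1) show False
  proof (cases rule: odd_prime_factor_or_4_dvd)
    case (1 p)
    then have "p \<le> n" using n by (auto intro: dvd_imp_le)
    moreover have "p dvd left_factorial n" using 1 n by (auto intro: dvd_trans)
    ultimately have "p dvd left_factorial p"
      using 1 left_factorial_cong[of p n] by (simp add: cong_dvd_iff)
    with H 1 show False by blast
  next
    case 2
    then have "n \<ge> 4" using n by (auto intro: dvd_imp_le)
    with 2 n show False using not_4_dvd_left_factorial dvd_trans by blast
  qed
qed auto

text \<open>Here \<open>d\<close> is the reduced denominator of the sum; the equation is the
  definition of the derangement number with \<open>d\<close> cleared.\<close>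

lemma numerator_derangement:
  obtains d where "coprime (numerator (\<Sum>k=0..n. (-1) ^ k / fact k)) d"
    "numerator (\<Sum>k=0..n. (-1) ^ k / fact k) * fact n = derangement n * d"
proof -
  define r :: rat where "r = (\<Sum>k=0..n. (-1) ^ k / fact k)"
  obtain a d where q: "quotient_of r = (a, d)" by fastforce
  have "d > 0" and cop: "coprime a d" and r: "r = of_int a / of_int d"
    using q by (auto intro: quotient_of_denom_pos quotient_of_coprime quotient_of_div)
  have "(of_int (derangement n * d) :: rat) = of_int (a * fact n)"
    using \<open>d > 0\<close> by (simp add: of_int_derangement r flip: r_def)
  then have "a * fact n = derangement n * d"
    by (metis of_int_eq_iff)
  with cop show thesis
    by (intro that[of d]) (simp_all add: numerator_def q flip: r_def)
qed

text \<open>The numerator divides \<open>derangement n * d\<close> and is coprime to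
  \<open>d\<close>.\<close>

lemma numerator_dvd_derangement:
  "numerator (\<Sum>k=0..n. (-1) ^ k / fact k) dvd derangement n"
proof -
  obtain d where "coprime (numerator (\<Sum>k=0..n. (-1) ^ k / fact k)) d"
    "numerator (\<Sum>k=0..n. (-1) ^ k / fact k) * fact n = derangement n * d"
    by (rule numerator_derangement)
  then show ?thesis
    by (metis coprime_dvd_mult_left_iff dvd_triv_left)
qed

text \<open>The forward direction is the preceding divisibility. For the converse, \<open>p\<close>
  divides the numerator times \<open>(p - 1)!\<close>, and the prime \<open>p\<close> does not
  divide the factorial.\<close>

lemma prime_dvd_numerator_iff:
  assumes "prime p"
  shows "int p dvd numerator (\<Sum>k=0..p-1. (-1) ^ k / fact k) \<longleftrightarrow> int p dvd derangement (p - 1)"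
    (is "_ dvd ?a \<longleftrightarrow> _")
proof
  assume "int p dvd derangement (p - 1)"
  moreover obtain d where "?a * fact (p - 1) = derangement (p - 1) * d"
    by (rule numerator_derangement)
  ultimately have "int p dvd ?a * fact (p - 1)" by simp
  moreover have "\<not> int p dvd fact (p - 1)"
  proof -
    have "\<not> p dvd fact (p - 1)"
      using assms prime_gt_0_nat[OF assms] by (simp add: prime_dvd_fact_iff)
    then show ?thesis by (metis int_dvd_int_iff of_nat_fact)
  qed
  ultimately show "int p dvd ?a"
    using assms by (simp add: prime_dvd_mult_iff)
qed (rule dvd_trans[OF _ numerator_dvd_derangement])

theorem theorem4:
  shows "(kurepa_hypothesis \<longleftrightarrow>
            (\<forall>p::nat. prime p \<and> p \<ge> 3 \<longrightarrow> \<not> [derangement (p - 1) = 0] (mod int p)))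
       \<and> ((\<forall>p::nat. prime p \<and> p \<ge> 3 \<longrightarrow> \<not> [derangement (p - 1) = 0] (mod int p)) \<longleftrightarrow>
            (\<forall>n::nat. n \<ge> 3 \<longrightarrow> \<not> [derangement (n - 1) = 0] (mod int n)))
       \<and> ((\<forall>n::nat. n \<ge> 3 \<longrightarrow> \<not> [derangement (n - 1) = 0] (mod int n)) \<longleftrightarrow>
            (\<forall>n::nat. n \<ge> 3 \<longrightarrow>
               \<not> int n dvd numerator (\<Sum>k=0..n-1. (-1) ^ k / fact k)))"
    (is "(_ \<longleftrightarrow> ?ii) \<and> (_ \<longleftrightarrow> ?iii) \<and> (_ \<longleftrightarrow> ?iv)")
proof -
  have ii: "?ii \<longleftrightarrow> (\<forall>p. prime p \<and> p \<ge> 3 \<longrightarrow> \<not> p dvd left_factorial p)"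
    using derangement_cong_0_iff prime_gt_0_nat by blast
  have iii: "?iii \<longleftrightarrow> (\<forall>n\<ge>3. \<not> n dvd left_factorial n)"
    using derangement_cong_0_iff by (metis gr0I not_numeral_le_zero)
  have "?ii \<longleftrightarrow> ?iii"
    unfolding ii iii by (rule dvd_left_factorial_prime_iff_all)
  moreover have "?iii \<Longrightarrow> ?iv"
    unfolding cong_0_iff using numerator_dvd_derangement dvd_trans by blast
  \<comment> \<open>The cycle is closed through primes: for composite \<open>n\<close> the factor
    \<open>(n - 1)!\<close> shares a prime with \<open>n\<close> and cannot be cancelled.\<close>
  moreover have "?iv \<Longrightarrow> ?ii"
    unfolding cong_0_iff using prime_dvd_numerator_iff by blast
  ultimately show ?thesis
    unfolding kurepa_hypothesis_iff_prime ii by blast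
qed

end
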